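(* Let $A\in\mathbb{C}^{n\times n}$ be Hermitian and let $E_{\mathrm{low}}=\{(k,\ell)\mid k>\ell,\ a_{k,\ell}\neq0\}$. Let $e_1,\dots,e_m$ with $m=|E_{\mathrm{low}}|$ be any ordering of the elements of $E_{\mathrm{low}}$. Let $r_e$, $z_e$ (for $e\in E_{\mathrm{low}}$) and the diagonal matrix $D$ be as defined in the context. Put $D_0=D$ and, successively for $j=1,\dots,m$, let $Q_j$ be a unitary matrix and $D_j$ a real diagonal matrix forming an eigendecomposition $$D_{j-1}+r_{e_j}\,\bigl(Q_{j-1}^H\cdots Q_1^H z_{e_j}\bigr)\bigl(Q_{j-1}^H\cdots Q_1^H z_{e_j}\bigr)^H=Q_jD_jQ_j^H .$$ Then $$A=\Bigl(\prod_{j=1}^m Q_j\Bigr)\,D_m\,\Bigl(\prod_{j=1}^m Q_j\Bigr)^H,\qquad \prod_{j=1}^m Q_j=Q_1Q_2\cdots Q_m,$$ is an eigendecomposition of $A$. That is, the eigensystem of $A$ is obtained from a sequence of $m$ eigenproblems of the form "diagonal matrix plus rank-one matrix".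
   Context: For $(k,\ell)\in E_{\mathrm{low}}$ write $a_{k,\ell}=r_{k,\ell}e^{i\theta_{k,\ell}}$ with $r_{k,\ell}=|a_{k,\ell}|$ and $\theta_{k,\ell}\in\mathbb{R}$. Define $z_{(k,\ell)}\in\mathbb{C}^n$ to have entry $1$ at position $\ell$, entry $e^{i\theta_{k,\ell}}$ at position $k$, and $0$ elsewhere. For $e=(k,\ell)$ write $r_e=r_{k,\ell}$ and $z_e=z_{(k,\ell)}$. $D=\operatorname{diag}(d_1,\dots,d_n)$ with $d_i=a_{i,i}-\sum_{j\neq i}|a_{i,j}|$. For $j=1$ the product $Q_{j-1}^H\cdots Q_1^H$ is the identity. Empty products equal the identity. $M^H$ denotes the conjugate transpose of $M$. *)

theory Defs
  imports
    Complex_Main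
    "Jordan_Normal_Form.Schur_Decomposition"
    "Jordan_Normal_Form.DL_Rank"
begin

(* All matrix and vector indices run over {0..<n}; the index shift preserves the
   strict order k > l that singles out the lower triangle.
   mat_adjoint, from Schur_Decomposition, is the conjugate transpose. *)

definition hermitian_mat :: "complex mat \<Rightarrow> bool" where
  "hermitian_mat A \<longleftrightarrow> square_mat A \<and> mat_adjoint A = A"

definition unitary_mat :: "nat \<Rightarrow> complex mat \<Rightarrow> bool" where
  "unitary_mat n Q \<longleftrightarrow>
     Q \<in> carrier_mat n n \<and> Q * mat_adjoint Q = 1\<^sub>m n \<and> mat_adjoint Q * Q = 1\<^sub>m n"

definition real_diagonal_mat :: "nat \<Rightarrow> complex mat \<Rightarrow> bool" where
  "real_diagonal_mat n D \<longleftrightarrow>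
     D \<in> carrier_mat n n \<and> diagonal_mat D \<and> (\<forall>i<n. D $$ (i, i) \<in> \<real>)"

definition eigendecomposition :: "nat \<Rightarrow> complex mat \<Rightarrow> complex mat \<Rightarrow> complex mat \<Rightarrow> bool" where
  "eigendecomposition n M Q D \<longleftrightarrow>
     unitary_mat n Q \<and> real_diagonal_mat n D \<and> M = Q * D * mat_adjoint Q"

definition mat_prod_list :: "nat \<Rightarrow> complex mat list \<Rightarrow> complex mat" where
  "mat_prod_list n Ms = foldr (*) Ms (1\<^sub>m n)"

(* v v^H *)
definition outer_self :: "complex vec \<Rightarrow> complex mat" where
  "outer_self v = mat (dim_vec v) (dim_vec v) (\<lambda>(i, j). v $ i * cnj (v $ j))"

definition E_low :: "complex mat \<Rightarrow> (nat \<times> nat) set" where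
  "E_low A = {(k, l). k < dim_row A \<and> l < dim_col A \<and> k > l \<and> A $$ (k, l) \<noteq> 0}"

definition edge_r :: "complex mat \<Rightarrow> nat \<times> nat \<Rightarrow> real" where
  "edge_r A e = cmod (A $$ e)"

(* \<theta> e is any real argument of the entry at e *)
definition is_phase :: "complex mat \<Rightarrow> (nat \<times> nat \<Rightarrow> real) \<Rightarrow> bool" where
  "is_phase A \<theta> \<longleftrightarrow>
     (\<forall>e \<in> E_low A. A $$ e = complex_of_real (edge_r A e) * exp (\<i> * complex_of_real (\<theta> e)))"

definition edge_z :: "nat \<Rightarrow> (nat \<times> nat \<Rightarrow> real) \<Rightarrow> nat \<times> nat \<Rightarrow> complex vec" where
  "edge_z n \<theta> = (\<lambda>(k, l).
     vec n (\<lambda>i. if i = l then 1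
                else if i = k then exp (\<i> * complex_of_real (\<theta> (k, l)))
                else 0))"

definition start_diag :: "nat \<Rightarrow> complex mat \<Rightarrow> complex mat" where
  "start_diag n A =
     mat_diag n (\<lambda>i. A $$ (i, i) - complex_of_real (\<Sum>j\<in>{0..<n} - {i}. cmod (A $$ (i, j))))"

(* r_(e_j) w w^H with w = Q_(j-1)^H ... Q_1^H z_(e_j), for 1 \<le> j \<le> m;
   the list es is indexed from 0, so e_j is es ! (j - 1) *)
definition rank_one_update ::
  "nat \<Rightarrow> complex mat \<Rightarrow> (nat \<times> nat \<Rightarrow> real) \<Rightarrow> (nat \<times> nat) list \<Rightarrow> (nat \<Rightarrow> complex mat) \<Rightarrow> nat \<Rightarrow> complex mat"
where
  "rank_one_update n A \<theta> es Q j =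
     complex_of_real (edge_r A (es ! (j - 1))) \<cdot>\<^sub>m
       outer_self (mat_prod_list n (map (\<lambda>i. mat_adjoint (Q i)) (rev [1..<j]))
                     *\<^sub>v edge_z n \<theta> (es ! (j - 1)))"

end

theory Submission
  imports Defs
begin

text \<open>
  The sum of \<open>r\<^sub>e z\<^sub>e z\<^sub>e\<^sup>H\<close> over the edges \<open>e\<close> has the off-diagonal part of \<open>A\<close>, and on the
  diagonal it contributes the absolute row sums that were subtracted in \<open>D\<close>; so it equals
  \<open>A - D\<close>. The invariant is that the first \<open>j\<close> steps diagonalise the partial sum: with
  \<open>P\<^sub>j = Q\<^sub>1 \<cdots> Q\<^sub>j\<close>, the matrix \<open>P\<^sub>j D\<^sub>j P\<^sub>j\<^sup>H\<close> is \<open>D\<close> plus the first \<open>j\<close> rank-one terms.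
\<close>

section \<open>Conjugate transpose\<close>

lemma dim_mat_adjoint [simp]:
  "dim_row (mat_adjoint A) = dim_col A" "dim_col (mat_adjoint A) = dim_row A"
  by (simp_all add: mat_adjoint_def)

lemma mat_adjoint_carrier [simp]:
  "A \<in> carrier_mat nr nc \<Longrightarrow> mat_adjoint A \<in> carrier_mat nc nr"
  by auto

lemma index_mat_adjoint:
  assumes "A \<in> carrier_mat nr nc" "i < nc" "j < nr"
  shows "mat_adjoint A $$ (i, j) = conjugate (A $$ (j, i))"
  using assms by (auto simp: mat_adjoint_def mat_of_rows_index)

lemma mat_adjoint_mult:
  fixes A B :: "complex mat"
  assumes A: "A \<in> carrier_mat nr n" and B: "B \<in> carrier_mat n nc"
  shows "mat_adjoint (A * B) = mat_adjoint B * mat_adjoint A"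
proof (rule eq_matI)
  fix i j assume "i < dim_row (mat_adjoint B * mat_adjoint A)"
    and "j < dim_col (mat_adjoint B * mat_adjoint A)"
  then have i: "i < nc" and j: "j < nr" using A B by auto
  have AB: "A * B \<in> carrier_mat nr nc" using A B by simp
  have "mat_adjoint (A * B) $$ (i, j) = (\<Sum>k<n. cnj (A $$ (j, k)) * cnj (B $$ (k, i)))"
    using A B i j by (simp add: index_mat_adjoint[OF AB] scalar_prod_def lessThan_atLeast0)
  also have "\<dots> = (mat_adjoint B * mat_adjoint A) $$ (i, j)"
    using A B i j
    by (auto simp: scalar_prod_def index_mat_adjoint[OF A] index_mat_adjoint[OF B] lessThan_atLeast0
        mult.commute intro!: sum.cong)
  finally show "mat_adjoint (A * B) $$ (i, j) = (mat_adjoint B * mat_adjoint A) $$ (i, j)" .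
qed auto

lemma mat_adjoint_one [simp]: "mat_adjoint (1\<^sub>m n :: complex mat) = 1\<^sub>m n"
  by (rule eq_matI) (auto simp: index_mat_adjoint[of _ n n])

section \<open>Unitary matrices\<close>

lemma unitary_matD:
  assumes "unitary_mat n Q"
  shows "Q \<in> carrier_mat n n" "Q * mat_adjoint Q = 1\<^sub>m n" "mat_adjoint Q * Q = 1\<^sub>m n"
  using assms by (auto simp: unitary_mat_def)

text \<open>Serves both unitarity identities of a product, where the inner pair
  \<open>Q * mat_adjoint Q\<close> or \<open>mat_adjoint P * P\<close> collapses.\<close>

lemma mult_cancel_mid:
  fixes X Y U V :: "complex mat"
  assumes "X \<in> carrier_mat n n" "Y \<in> carrier_mat n n" "U \<in> carrier_mat n n"
    "V \<in> carrier_mat n n" and UV: "U * V = 1\<^sub>m n"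
  shows "(X * U) * (V * Y) = X * Y"
proof -
  have "(X * U) * (V * Y) = X * (U * (V * Y))" using assms by (simp add: assoc_mult_mat[of _ n n _ n _ n])
  also have "U * (V * Y) = (U * V) * Y" using assms(2-4) by (simp add: assoc_mult_mat[of _ n n _ n _ n])
  finally show ?thesis using assms(2) UV by simp
qed

lemma unitary_mat_one: "unitary_mat n (1\<^sub>m n)"
  by (simp add: unitary_mat_def)

lemma unitary_mat_mult:
  assumes P: "unitary_mat n P" and Q: "unitary_mat n Q"
  shows "unitary_mat n (P * Q)"
proof -
  note p = unitary_matD[OF P] and q = unitary_matD[OF Q]
  have adj: "mat_adjoint (P * Q) = mat_adjoint Q * mat_adjoint P"
    by (rule mat_adjoint_mult[OF p(1) q(1)])
  show ?thesis
    unfolding unitary_mat_def adj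
    using mult_cancel_mid[OF p(1) _ q(1) _ q(2), of "mat_adjoint P"]
      mult_cancel_mid[OF _ q(1) _ p(1) p(3), of "mat_adjoint Q"] p q
    by simp
qed

section \<open>Ordered products\<close>

lemma mat_prod_list_carrier:
  "set Ms \<subseteq> carrier_mat n n \<Longrightarrow> mat_prod_list n Ms \<in> carrier_mat n n"
  by (induction Ms) (auto simp: mat_prod_list_def)

text \<open>The \<open>foldr\<close> peels factors off on the left, whereas the iteration appends
  each new factor on the right.\<close>

lemma mat_prod_list_snoc:
  assumes "set Ms \<subseteq> carrier_mat n n" "M \<in> carrier_mat n n"
  shows "mat_prod_list n (Ms @ [M]) = mat_prod_list n Ms * M"
  using assms
proof (induction Ms)
  case Nil
  then show ?case by (simp add: mat_prod_list_def)
next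
  case (Cons X Ms)
  then have "mat_prod_list n ((X # Ms) @ [M]) = X * (mat_prod_list n Ms * M)"
    by (simp add: mat_prod_list_def)
  also have "\<dots> = X * mat_prod_list n Ms * M"
    using Cons.prems mat_prod_list_carrier[of Ms n] by (simp add: assoc_mult_mat[of _ n n _ n _ n])
  finally show ?case by (simp add: mat_prod_list_def)
qed

text \<open>Identifies the accumulated factor Q_(j-1)^H ... Q_1^H inside
  \<open>rank_one_update\<close> with the adjoint of the product Q_1 ... Q_(j-1).\<close>

lemma mat_prod_list_adjoint_rev:
  assumes "set Ms \<subseteq> carrier_mat n n"
  shows "mat_prod_list n (map mat_adjoint (rev Ms)) = mat_adjoint (mat_prod_list n Ms)"
  using assms
proof (induction Ms)
  case Nil
  then show ?case by (simp add: mat_prod_list_def)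
next
  case (Cons M Ms)
  then have c: "M \<in> carrier_mat n n" "set (map mat_adjoint (rev Ms)) \<subseteq> carrier_mat n n"
    by auto
  have "mat_prod_list n (map mat_adjoint (rev (M # Ms)))
      = mat_adjoint (mat_prod_list n Ms) * mat_adjoint M"
    using Cons mat_prod_list_snoc[OF c(2), of "mat_adjoint M"] by simp
  also have "\<dots> = mat_adjoint (M * mat_prod_list n Ms)"
    using Cons.prems mat_prod_list_carrier[of Ms n] by (simp add: mat_adjoint_mult[of _ n n _ n])
  finally show ?case by (simp add: mat_prod_list_def)
qed

section \<open>The matrices v v^H under conjugation\<close>

lemma outer_self_carrier [simp]: "v \<in> carrier_vec n \<Longrightarrow> outer_self v \<in> carrier_mat n n"
  by (simp add: outer_self_def)

lemma outer_self_mult_mat_vec: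
  assumes M: "M \<in> carrier_mat n n" and v: "v \<in> carrier_vec n"
  shows "outer_self (M *\<^sub>v v) = M * outer_self v * mat_adjoint M"
proof (rule eq_matI)
  fix i j assume "i < dim_row (M * outer_self v * mat_adjoint M)"
    and "j < dim_col (M * outer_self v * mat_adjoint M)"
  then have ij: "i < n" "j < n" using M by auto
  have "(M * outer_self v * mat_adjoint M) $$ (i, j)
      = (\<Sum>l<n. (\<Sum>k<n. M $$ (i, k) * (v $ k * cnj (v $ l))) * cnj (M $$ (j, l)))"
    using M v ij
    by (auto simp: scalar_prod_def outer_self_def index_mat_adjoint[OF M] lessThan_atLeast0
        intro!: sum.cong)
  \<comment> \<open>The double sum separates because each entry of v v^H is a factor in
    \<open>k\<close> times a factor in \<open>l\<close>.\<close>
  also have "\<dots> = (\<Sum>k<n. M $$ (i, k) * v $ k) * cnj (\<Sum>l<n. M $$ (j, l) * v $ l)"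
    by (simp add: sum_product sum_distrib_right sum_distrib_left cnj_sum mult_ac)
  also have "\<dots> = outer_self (M *\<^sub>v v) $$ (i, j)"
    using M v ij by (simp add: outer_self_def scalar_prod_def lessThan_atLeast0)
  finally show "outer_self (M *\<^sub>v v) $$ (i, j) = (M * outer_self v * mat_adjoint M) $$ (i, j)" ..
qed (use M in \<open>auto simp: outer_self_def\<close>)

text \<open>This drives the induction: since P P^H z = z, conjugating by \<open>P\<close> undoes the
  rotation of \<open>z\<close>, and the update returns to the original coordinates as z z^H.\<close>

lemma conjugate_rank_one_update:
  assumes P: "unitary_mat n P" and D: "D \<in> carrier_mat n n" and z: "z \<in> carrier_vec n"
  shows "P * (D + c \<cdot>\<^sub>m outer_self (mat_adjoint P *\<^sub>v z)) * mat_adjoint P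
    = P * D * mat_adjoint P + c \<cdot>\<^sub>m outer_self z"
proof -
  note p = unitary_matD[OF P]
  have w: "mat_adjoint P *\<^sub>v z \<in> carrier_vec n" using p z by (auto intro!: mult_mat_vec_carrier)
  have "P *\<^sub>v (mat_adjoint P *\<^sub>v z) = z"
    using p z by (simp add: assoc_mult_mat_vec[of _ n n _ n, symmetric])
  then have outer: "P * outer_self (mat_adjoint P *\<^sub>v z) * mat_adjoint P = outer_self z"
    using outer_self_mult_mat_vec[OF p(1) w] by simp
  have PD: "P * D \<in> carrier_mat n n" "P * outer_self (mat_adjoint P *\<^sub>v z) \<in> carrier_mat n n"
    using p D w by auto
  have "P * (D + c \<cdot>\<^sub>m outer_self (mat_adjoint P *\<^sub>v z)) * mat_adjoint P
      = (P * D + c \<cdot>\<^sub>m (P * outer_self (mat_adjoint P *\<^sub>v z))) * mat_adjoint P"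
    using p D w by (simp add: mult_add_distrib_mat[of _ n n _ n] mult_smult_distrib[of _ n n _ n])
  also have "\<dots> = P * D * mat_adjoint P
      + c \<cdot>\<^sub>m (P * outer_self (mat_adjoint P *\<^sub>v z) * mat_adjoint P)"
    using p PD
    by (subst add_mult_distrib_mat[of _ n n _ _ n]) (auto simp: mult_smult_assoc_mat[of _ n n _ n])
  finally show ?thesis unfolding outer .
qed

section \<open>Rank of the updates\<close>

lemma unitary_adjoint_mult_vec_eq_0:
  assumes P: "unitary_mat n P" and z: "z \<in> carrier_vec n"
    and "mat_adjoint P *\<^sub>v z = 0\<^sub>v n"
  shows "z = 0\<^sub>v n"
proof -
  note p = unitary_matD[OF P]
  have "z = P *\<^sub>v (mat_adjoint P *\<^sub>v z)"
    using p z by (simp add: assoc_mult_mat_vec[of _ n n _ n, symmetric])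
  also have "\<dots> = 0\<^sub>v n" using assms(3) p by auto
  finally show ?thesis .
qed

text \<open>Column \<open>j\<close> is nonzero, hence by itself a linearly independent set of
  columns.\<close>

lemma (in vec_space) rank_ge_1:
  assumes A: "A \<in> carrier_mat n nc" and "i < n" "j < nc" and nz: "A $$ (i, j) \<noteq> 0"
  shows "1 \<le> rank A"
proof -
  have c: "col A j \<in> carrier_vec n" using A by auto
  have "col A j \<noteq> 0\<^sub>v n" using assms by (metis carrier_matD index_col index_zero_vec(1))
  then have "lin_indpt {col A j}"
    using c by (simp add: lindep_span span_empty)
  moreover have "{col A j} \<subseteq> set (cols A)" using A \<open>j < nc\<close> by (auto simp: cols_def)
  ultimately show ?thesis using rank_ge_card_indpt[OF A, of "{col A j}"] by simp
qed

text \<open>The entries are products of a row factor and a column factor, which bounds the rank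
  above. Below, a nonzero coordinate \<open>v $ i\<close> gives the nonzero diagonal entry c
  |v_i|^2.\<close>

lemma rank_smult_outer_self:
  assumes v: "v \<in> carrier_vec n" "v \<noteq> 0\<^sub>v n" and c: "c \<noteq> 0"
  shows "vec_space.rank n (c \<cdot>\<^sub>m outer_self v) = 1"
proof (rule antisym)
  have o: "c \<cdot>\<^sub>m outer_self v \<in> carrier_mat n n" using v by simp
  show "vec_space.rank n (c \<cdot>\<^sub>m outer_self v) \<le> 1"
    by (rule vec_space.rank_le_1_product_entries[OF o, of "\<lambda>r. c * v $ r" "\<lambda>s. cnj (v $ s)"])
      (use v in \<open>auto simp: outer_self_def\<close>)
  obtain i where i: "i < n" "v $ i \<noteq> 0" using v by (metis carrier_vecD eq_vecI index_zero_vec)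
  show "1 \<le> vec_space.rank n (c \<cdot>\<^sub>m outer_self v)"
    by (rule vec_space.rank_ge_1[OF o i(1) i(1)]) (use v i c in \<open>auto simp: outer_self_def\<close>)
qed

section \<open>Edge vectors and the splitting of \<open>A\<close>\<close>

lemma edge_z_carrier [simp]: "edge_z n \<theta> e \<in> carrier_vec n"
  by (auto simp: edge_z_def split: prod.splits)

lemma hermitian_mat_sym:
  assumes "A \<in> carrier_mat n n" "hermitian_mat A" "i < n" "j < n"
  shows "A $$ (i, j) = cnj (A $$ (j, i))"
  using index_mat_adjoint[OF assms(1,3,4)] assms(2) by (simp add: hermitian_mat_def)

lemma real_diagonal_start_diag:
  assumes A: "A \<in> carrier_mat n n" "hermitian_mat A"
  shows "real_diagonal_mat n (start_diag n A)"
proof -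
  have "A $$ (i, i) \<in> \<real>" if "i < n" for i
    using hermitian_mat_sym[OF A that that] by (simp add: Reals_cnj_iff)
  then show ?thesis
    by (auto simp: real_diagonal_mat_def start_diag_def mat_diag_def diagonal_mat_def
        simp del: of_real_sum)
qed

lemma finite_E_low: "finite (E_low A)"
  by (rule finite_subset[of _ "{..<dim_row A} \<times> {..<dim_col A}"]) (auto simp: E_low_def)

text \<open>The edges at \<open>a\<close> correspond to the nonzero off-diagonal entries of row
  \<open>a\<close>; an entry above the diagonal has the same modulus as its mirror image in
  \<open>E_low A\<close>.\<close>

lemma sum_edges_row:
  assumes A: "A \<in> carrier_mat n n" "hermitian_mat A" and a: "a < n"
  shows "(\<Sum>e\<in>{e \<in> E_low A. a = fst e \<or> a = snd e}. edge_r A e)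
    = (\<Sum>j\<in>{0..<n} - {a}. cmod (A $$ (a, j)))"
proof -
  \<comment> \<open>\<open>g\<close> sends an edge at \<open>a\<close> to its other endpoint;
    \<open>h\<close> rebuilds the edge with the larger endpoint first, as \<open>E_low\<close>
    requires.\<close>
  define g where "g = (\<lambda>e::nat \<times> nat. if fst e = a then snd e else fst e)"
  define h where "h = (\<lambda>j. (max a j, min a j))"
  have "(\<Sum>e\<in>{e \<in> E_low A. a = fst e \<or> a = snd e}. edge_r A e)
      = (\<Sum>j\<in>{j \<in> {0..<n} - {a}. A $$ (a, j) \<noteq> 0}. cmod (A $$ (a, j)))"
  proof (rule sum.reindex_bij_witness[where i = h and j = g])
    fix e assume "e \<in> {e \<in> E_low A. a = fst e \<or> a = snd e}"
    then obtain k l where e: "e = (k, l)" "l < k" "k < n" "A $$ (k, l) \<noteq> 0" "a = k \<or> a = l"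
      using A by (cases e) (auto simp: E_low_def)
    show "h (g e) = e" using e by (auto simp: h_def g_def)
    show "g e \<in> {j \<in> {0..<n} - {a}. A $$ (a, j) \<noteq> 0}"
      using e hermitian_mat_sym[OF A, of k l] by (auto simp: g_def)
    show "cmod (A $$ (a, g e)) = edge_r A e"
      using e hermitian_mat_sym[OF A, of k l] by (auto simp: g_def edge_r_def)
  next
    fix j assume j: "j \<in> {j \<in> {0..<n} - {a}. A $$ (a, j) \<noteq> 0}"
    show "g (h j) = j" using j by (auto simp: h_def g_def max_def min_def)
    show "h j \<in> {e \<in> E_low A. a = fst e \<or> a = snd e}"
      using j a A hermitian_mat_sym[OF A, of j a] by (auto simp: h_def E_low_def max_def min_def)
  qed
  \<comment> \<open>Zero entries can be put back, as their modulus is 0.\<close>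
  also have "\<dots> = (\<Sum>j\<in>{0..<n} - {a}. cmod (A $$ (a, j)))"
    by (rule sum.mono_neutral_left) auto
  finally show ?thesis .
qed

text \<open>On the diagonal the incident edges restore exactly the row sum removed by
  \<open>start_diag\<close>. Off the diagonal a single edge can contribute.\<close>

lemma edge_decomposition:
  assumes A: "A \<in> carrier_mat n n" "hermitian_mat A" and ph: "is_phase A \<theta>"
    and a: "a < n" and b: "b < n"
  shows "start_diag n A $$ (a, b)
      + (\<Sum>e\<in>E_low A. edge_r A e * (edge_z n \<theta> e $ a * cnj (edge_z n \<theta> e $ b)))
    = A $$ (a, b)"
proof -
  define f where "f = (\<lambda>e. edge_r A e * (edge_z n \<theta> e $ a * cnj (edge_z n \<theta> e $ b)))"
  show ?thesis
  proof (cases "a = b")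
    case True
    \<comment> \<open>A phase has modulus 1, so the squared modulus of
      \<open>edge_z n \<theta> e $ a\<close> is 1 at both endpoints and 0 elsewhere.\<close>
    have "(\<Sum>e\<in>E_low A. f e) = (\<Sum>e\<in>E_low A. if a = fst e \<or> a = snd e then of_real (edge_r A e) else 0)"
    proof (rule sum.cong[OF refl])
      fix e assume "e \<in> E_low A"
      then show "f e = (if a = fst e \<or> a = snd e then of_real (edge_r A e) else 0)"
        using a True by (cases e) (auto simp: f_def edge_z_def complex_norm_square[symmetric])
    qed
    also have "\<dots> = of_real (\<Sum>e\<in>{e \<in> E_low A. a = fst e \<or> a = snd e}. edge_r A e)"
      using finite_E_low by (simp add: sum.inter_filter if_distrib cong: if_cong)
    also have "\<dots> = of_real (\<Sum>j\<in>{0..<n} - {a}. cmod (A $$ (a, j)))"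
      using sum_edges_row[OF A a] by simp
    finally show ?thesis
      unfolding f_def using True a by (simp add: start_diag_def mat_diag_def)
  next
    case False
    \<comment> \<open>The only possible edge whose vector is nonzero at both \<open>a\<close> and
      \<open>b\<close>.\<close>
    define p where "p = (max a b, min a b)"
    have zero: "f e = 0" if "e \<in> E_low A" "e \<noteq> p" for e
      using that a b False
      by (cases e) (auto simp: f_def p_def edge_z_def E_low_def max_def min_def split: if_splits)
    have "(\<Sum>e\<in>E_low A. f e) = (\<Sum>e\<in>E_low A. if e = p then f p else 0)"
      using zero by (intro sum.cong) auto
    also have "\<dots> = (if p \<in> E_low A then f p else 0)"
      using finite_E_low by simp
    also have "\<dots> = A $$ (a, b)"
    proof (cases "p \<in> E_low A")
      case True
      then have ph': "A $$ p = of_real (edge_r A p) * exp (\<i> * of_real (\<theta> p))"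
        using ph by (auto simp: is_phase_def)
      \<comment> \<open>The phase sits at the larger endpoint: it enters unconjugated below the
        diagonal and conjugated above it, in line with Hermitian symmetry.\<close>
      show ?thesis
      proof (cases "a > b")
        case True
        then show ?thesis
          using ph' \<open>p \<in> E_low A\<close> a b by (simp add: f_def p_def edge_z_def)
      next
        case False
        then have "A $$ (a, b) = cnj (A $$ p)"
          using hermitian_mat_sym[OF A a b] by (simp add: p_def)
        also have "\<dots> = of_real (edge_r A p) * cnj (exp (\<i> * of_real (\<theta> p)))"
          unfolding ph' by simp
        finally show ?thesis
          using False \<open>a \<noteq> b\<close> \<open>p \<in> E_low A\<close> a b by (simp add: f_def p_def edge_z_def)
      qed
    next
      \<comment> \<open>Here the entry at \<open>p\<close> vanishes, and by symmetry so does the one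
        at \<open>(a, b)\<close>.\<close>
      case False
      then show ?thesis
        using a b A \<open>a \<noteq> b\<close> hermitian_mat_sym[OF A a b]
        by (auto simp: p_def E_low_def max_def min_def split: if_splits)
    qed
    finally show ?thesis
      unfolding f_def using False a b by (simp add: start_diag_def mat_diag_def)
  qed
qed

text \<open>The second conjunct makes "diagonal plus rank-one" precise: every update has rank
  exactly one, and the matrix it is added to is real diagonal.\<close>

theorem mainTheorem2:
  fixes n m :: nat
    and A :: "complex mat"
    and \<theta> :: "nat \<times> nat \<Rightarrow> real"
    and es :: "(nat \<times> nat) list"
    and Q D :: "nat \<Rightarrow> complex mat"
  assumes "A \<in> carrier_mat n n"
    and "hermitian_mat A"
    and "is_phase A \<theta>"
    and "set es = E_low A" and "distinct es" and "m = card (E_low A)"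
    and "D 0 = start_diag n A"
    and "\<And>j. j \<in> {1..m} \<Longrightarrow>
           eigendecomposition n (D (j - 1) + rank_one_update n A \<theta> es Q j) (Q j) (D j)"
  shows "eigendecomposition n A (mat_prod_list n (map Q [1..<Suc m])) (D m)
    \<and> (\<forall>j\<in>{1..m}. real_diagonal_mat n (D (j - 1))
                  \<and> vec_space.rank n (rank_one_update n A \<theta> es Q j) = 1)"
proof -
  define P where "P = (\<lambda>j. mat_prod_list n (map Q [1..<Suc j]))"
  \<comment> \<open>\<open>z\<close> and \<open>r\<close> are indexed from 0 like the list, so
    \<open>z j\<close> and \<open>r j\<close> belong to step \<open>Suc j\<close>, whose vector is
    rotated by the adjoint of \<open>P j\<close>.\<close>
  define z where "z = (\<lambda>i. edge_z n \<theta> (es ! i))"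
  define r where "r = (\<lambda>i. complex_of_real (edge_r A (es ! i)))"
  have len: "length es = m" using assms(4-6) by (metis distinct_card)
  have z: "z i \<in> carrier_vec n" for i by (simp add: z_def)
  have eig: "eigendecomposition n (D j + rank_one_update n A \<theta> es Q (Suc j)) (Q (Suc j)) (D (Suc j))"
    if "j < m" for j
    using assms(8)[of "Suc j"] that by simp
  have Q: "unitary_mat n (Q i)" if "i \<in> {1..m}" for i
    using assms(8)[OF that] by (simp add: eigendecomposition_def)
  have Dr: "real_diagonal_mat n (D j)" if "j \<le> m" for j
    using that eig[of "j - 1"] assms(7) real_diagonal_start_diag[OF assms(1,2)]
    by (cases j) (auto simp: eigendecomposition_def)
  have Qs: "set (map Q [1..<Suc j]) \<subseteq> carrier_mat n n" if "j \<le> m" for j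
    using that by (auto intro!: unitary_matD(1) Q)
  have PSuc: "P (Suc j) = P j * Q (Suc j)" if "j < m" for j
    using mat_prod_list_snoc[OF Qs, of j "Q (Suc j)"] that unitary_matD(1)[OF Q, of "Suc j"]
    by (simp add: P_def)
  have P: "unitary_mat n (P j)" if "j \<le> m" for j
    using that
  proof (induction j)
    case 0
    show ?case by (simp add: P_def mat_prod_list_def unitary_mat_one)
  next
    case (Suc j)
    then show ?case using PSuc[of j] Q[of "Suc j"] by (simp add: unitary_mat_mult)
  qed
  have upd: "rank_one_update n A \<theta> es Q (Suc j) = r j \<cdot>\<^sub>m outer_self (mat_adjoint (P j) *\<^sub>v z j)"
    if "j < m" for j
  proof -
    have "map (\<lambda>i. mat_adjoint (Q i)) (rev [1..<Suc j]) = map mat_adjoint (rev (map Q [1..<Suc j]))"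
      by (simp add: rev_map)
    then show ?thesis
      using mat_prod_list_adjoint_rev[OF Qs, of j] that
      by (simp only: rank_one_update_def P_def r_def z_def diff_Suc_1 less_imp_le)
  qed
  \<comment> \<open>The partial sum is written entrywise so that at \<open>j = m\<close> it can be
    compared with \<open>edge_decomposition\<close>.\<close>
  have inv: "P j * D j * mat_adjoint (P j)
      = mat n n (\<lambda>(a, b). D 0 $$ (a, b) + (\<Sum>i<j. r i * (z i $ a * cnj (z i $ b))))"
    if "j \<le> m" for j
    using that
  proof (induction j)
    case 0
    have "D 0 \<in> carrier_mat n n" using Dr[of 0] by (simp add: real_diagonal_mat_def)
    then show ?case by (auto simp: P_def mat_prod_list_def)
  next
    case (Suc j)
    then have j: "j < m" by simp
    note p = unitary_matD[OF P[of j]] and q = unitary_matD[OF Q[of "Suc j"]]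
    have c: "D j \<in> carrier_mat n n" "D (Suc j) \<in> carrier_mat n n"
      using Dr[of j] Dr[of "Suc j"] Suc.prems by (simp_all add: real_diagonal_mat_def)
    have adj: "mat_adjoint (P (Suc j)) = mat_adjoint (Q (Suc j)) * mat_adjoint (P j)"
      using PSuc[OF j] p(1) q(1) Suc.prems by (simp add: mat_adjoint_mult[of _ n n _ n])
    have carr: "P j \<in> carrier_mat n n" "Q (Suc j) \<in> carrier_mat n n"
      "mat_adjoint (P j) \<in> carrier_mat n n" "mat_adjoint (Q (Suc j)) \<in> carrier_mat n n"
      using p(1) q(1) Suc.prems by simp_all
    \<comment> \<open>Regroups so that the eigendecomposition of step \<open>Suc j\<close> appears
      between \<open>P j\<close> and its adjoint.\<close>
    have assoc: "X * Y * Z * (U * V) = X * (Y * Z * U) * V"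
      if "X \<in> carrier_mat n n" "Y \<in> carrier_mat n n" "Z \<in> carrier_mat n n"
        "U \<in> carrier_mat n n" "V \<in> carrier_mat n n" for X Y Z U V :: "complex mat"
      using that by (simp add: assoc_mult_mat[of _ n n _ n _ n])
    have "P (Suc j) * D (Suc j) * mat_adjoint (P (Suc j))
        = P j * (Q (Suc j) * D (Suc j) * mat_adjoint (Q (Suc j))) * mat_adjoint (P j)"
      unfolding adj unfolding PSuc[OF j] using carr c(2) by (intro assoc)
    also have "\<dots> = P j * (D j + r j \<cdot>\<^sub>m outer_self (mat_adjoint (P j) *\<^sub>v z j)) * mat_adjoint (P j)"
      using eig[OF j] upd[OF j] by (simp add: eigendecomposition_def)
    also have "\<dots> = P j * D j * mat_adjoint (P j) + r j \<cdot>\<^sub>m outer_self (z j)"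
      using conjugate_rank_one_update[OF P c(1) z] Suc.prems by simp
    also have "\<dots> = mat n n (\<lambda>(a, b). D 0 $$ (a, b) + (\<Sum>i<Suc j. r i * (z i $ a * cnj (z i $ b))))"
      using Suc z[of j] by (intro eq_matI) (auto simp: outer_self_def)
    finally show ?case .
  qed
  have "A = P m * D m * mat_adjoint (P m)"
  proof -
    \<comment> \<open>Each edge occurs at exactly one list position, so the chosen ordering
      disappears from the sum.\<close>
    have sum: "(\<Sum>i<m. r i * (z i $ a * cnj (z i $ b)))
        = (\<Sum>e\<in>E_low A. edge_r A e * (edge_z n \<theta> e $ a * cnj (edge_z n \<theta> e $ b)))" for a b
      unfolding r_def z_def
      by (rule sum.reindex_bij_betw[OF bij_betw_nth[OF assms(5)]]) (use len assms(4) in auto)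
    show ?thesis
      unfolding inv[OF order_refl] sum assms(7)
      using assms(1) by (intro eq_matI) (auto simp: edge_decomposition[OF assms(1-3)])
  qed
  then have "eigendecomposition n A (P m) (D m)"
    using P[of m] Dr[of m] by (simp add: eigendecomposition_def)
  moreover have "vec_space.rank n (rank_one_update n A \<theta> es Q (Suc j)) = 1" if j: "j < m" for j
  proof -
    \<comment> \<open>Membership in \<open>E_low A\<close> makes the weight nonzero, and the entry 1
      at position \<open>l\<close> makes the edge vector nonzero.\<close>
    obtain k l where e: "es ! j = (k, l)" "(k, l) \<in> E_low A"
      using j len assms(4) by (metis nth_mem surj_pair)
    then have l: "l < n" and nz: "r j \<noteq> 0"
      using assms(1) by (auto simp: E_low_def r_def edge_r_def)
    have "z j $ l = 1" using l by (simp add: z_def e edge_z_def)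
    then have "z j \<noteq> 0\<^sub>v n" using l by auto
    then have "mat_adjoint (P j) *\<^sub>v z j \<noteq> 0\<^sub>v n"
      using unitary_adjoint_mult_vec_eq_0[OF P[of j] z[of j]] j by auto
    moreover have "mat_adjoint (P j) *\<^sub>v z j \<in> carrier_vec n"
      using unitary_matD(1)[OF P[of j]] j z by (auto intro!: mult_mat_vec_carrier)
    ultimately show ?thesis
      unfolding upd[OF j] using nz by (intro rank_smult_outer_self)
  qed
  ultimately show ?thesis
    using Dr unfolding P_def by (auto simp: Ball_def Suc_le_eq gr0_conv_Suc)
qed

end
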